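(* $\mathbf{GV}$ and $\mathbf{LV}$ have the same theorems.
   Context: Let $\mathcal L$ be the language of classical propositional logic $\{\land,\lor,\to,0,1\}$ over a denumerable set of variables, expanded with a binary connective $\mathbin{\Box\!\!\rightarrow}$ (the counterfactual conditional), with $\neg x := x\to 0$ and $x\leftrightarrow y := (x\to y)\land(y\to x)$. Consider the axioms: (L0) a Hilbert-style axiomatization of classical propositional logic; (L1) $\varphi\mathbin{\Box\!\!\rightarrow}\varphi$; (L2) $((\varphi\mathbin{\Box\!\!\rightarrow}\psi)\wedge(\psi\mathbin{\Box\!\!\rightarrow}\varphi))\to((\varphi\mathbin{\Box\!\!\rightarrow}\gamma)\leftrightarrow(\psi\mathbin{\Box\!\!\rightarrow}\gamma))$; (L3) $((\varphi\vee\psi)\mathbin{\Box\!\!\rightarrow}\varphi)\vee((\varphi\vee\psi)\mathbin{\Box\!\!\rightarrow}\psi)\vee(((\varphi\vee\psi)\mathbin{\Box\!\!\rightarrow}\gamma)\leftrightarrow((\varphi\mathbin{\Box\!\!\rightarrow}\gamma)\wedge(\psi\mathbin{\Box\!\!\rightarrow}\gamma)))$; (L4) $(\varphi\mathbin{\Box\!\!\rightarrow}(\psi\land\gamma))\leftrightarrow((\varphi\mathbin{\Box\!\!\rightarrow}\psi)\land(\varphi\mathbin{\Box\!\!\rightarrow}\gamma))$. The logic $\mathbf{GV}$ is the smallest finitary consequence relation containing (L0)–(L4) and satisfying modus ponens (MP) $\varphi,\varphi\to\psi\vdash\psi$ and the rule (C) $\varphi\to\psi\vdash(\gamma\mathbin{\Box\!\!\rightarrow}\varphi)\to(\gamma\mathbin{\Box\!\!\rightarrow}\psi)$.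 The logic $\mathbf{LV}$ is the smallest finitary consequence relation containing (L0)–(L4) and satisfying (MP) and the weak rule (wC): if $\vdash\varphi\to\psi$ then $\vdash(\gamma\mathbin{\Box\!\!\rightarrow}\varphi)\to(\gamma\mathbin{\Box\!\!\rightarrow}\psi)$. *)

theory Defs
  imports Main
begin

datatype form =
    Var nat
  | Zero (\<open>\<^bold>0\<close>)
  | One (\<open>\<^bold>1\<close>)
  | Conj form form (infixr \<open>\<^bold>\<and>\<close> 70)
  | Disj form form (infixr \<open>\<^bold>\<or>\<close> 65)
  | Imp form form (infixr \<open>\<^bold>\<rightarrow>\<close> 60)
  | Cf form form (infix \<open>\<box>\<rightarrow>\<close> 75)

abbreviation Neg :: "form \<Rightarrow> form" (\<open>\<^bold>\<not> _\<close> [80] 80)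
  where "\<^bold>\<not> \<phi> \<equiv> (\<phi> \<^bold>\<rightarrow> \<^bold>0)"

abbreviation Iff :: "form \<Rightarrow> form \<Rightarrow> form" (infix \<open>\<^bold>\<leftrightarrow>\<close> 55)
  where "(\<phi> \<^bold>\<leftrightarrow> \<psi>) \<equiv> ((\<phi> \<^bold>\<rightarrow> \<psi>) \<^bold>\<and> (\<psi> \<^bold>\<rightarrow> \<phi>))"

text \<open>
  A standard Hilbert-style axiomatization of classical propositional logic in
  \<open>\<and>, \<or>, \<rightarrow>, 0, 1\<close>, complete with modus ponens as its only rule. The schemata range
  over all formulas, including those built with the counterfactual.
\<close>

inductive_set classical_axioms :: "form set" where
  "\<phi> \<^bold>\<rightarrow> (\<psi> \<^bold>\<rightarrow> \<phi>) \<in> classical_axioms"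
| "(\<phi> \<^bold>\<rightarrow> (\<psi> \<^bold>\<rightarrow> \<gamma>)) \<^bold>\<rightarrow> ((\<phi> \<^bold>\<rightarrow> \<psi>) \<^bold>\<rightarrow> (\<phi> \<^bold>\<rightarrow> \<gamma>)) \<in> classical_axioms"
| "(\<phi> \<^bold>\<and> \<psi>) \<^bold>\<rightarrow> \<phi> \<in> classical_axioms"
| "(\<phi> \<^bold>\<and> \<psi>) \<^bold>\<rightarrow> \<psi> \<in> classical_axioms"
| "\<phi> \<^bold>\<rightarrow> (\<psi> \<^bold>\<rightarrow> (\<phi> \<^bold>\<and> \<psi>)) \<in> classical_axioms"
| "\<phi> \<^bold>\<rightarrow> (\<phi> \<^bold>\<or> \<psi>) \<in> classical_axioms"
| "\<psi> \<^bold>\<rightarrow> (\<phi> \<^bold>\<or> \<psi>) \<in> classical_axioms"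
| "(\<phi> \<^bold>\<rightarrow> \<gamma>) \<^bold>\<rightarrow> ((\<psi> \<^bold>\<rightarrow> \<gamma>) \<^bold>\<rightarrow> ((\<phi> \<^bold>\<or> \<psi>) \<^bold>\<rightarrow> \<gamma>)) \<in> classical_axioms"
| "\<^bold>0 \<^bold>\<rightarrow> \<phi> \<in> classical_axioms"
| "\<^bold>1 \<in> classical_axioms"
| "\<^bold>\<not> \<^bold>\<not> \<phi> \<^bold>\<rightarrow> \<phi> \<in> classical_axioms"

inductive_set lewis_axioms :: "form set" where
  L0: "\<phi> \<in> classical_axioms \<Longrightarrow> \<phi> \<in> lewis_axioms"
| L1: "\<phi> \<box>\<rightarrow> \<phi> \<in> lewis_axioms"
| L2: "((\<phi> \<box>\<rightarrow> \<psi>) \<^bold>\<and> (\<psi> \<box>\<rightarrow> \<phi>)) \<^bold>\<rightarrow> ((\<phi> \<box>\<rightarrow> \<gamma>) \<^bold>\<leftrightarrow> (\<psi> \<box>\<rightarrow> \<gamma>)) \<in> lewis_axioms"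
| L3: "((\<phi> \<^bold>\<or> \<psi>) \<box>\<rightarrow> \<phi>) \<^bold>\<or> ((\<phi> \<^bold>\<or> \<psi>) \<box>\<rightarrow> \<psi>) \<^bold>\<or>
       (((\<phi> \<^bold>\<or> \<psi>) \<box>\<rightarrow> \<gamma>) \<^bold>\<leftrightarrow> ((\<phi> \<box>\<rightarrow> \<gamma>) \<^bold>\<and> (\<psi> \<box>\<rightarrow> \<gamma>))) \<in> lewis_axioms"
| L4: "(\<phi> \<box>\<rightarrow> (\<psi> \<^bold>\<and> \<gamma>)) \<^bold>\<leftrightarrow> ((\<phi> \<box>\<rightarrow> \<psi>) \<^bold>\<and> (\<phi> \<box>\<rightarrow> \<gamma>)) \<in> lewis_axioms"

type_synonym conseq = "form set \<Rightarrow> form \<Rightarrow> bool"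

text \<open>
  Monotonicity follows from reflexivity and cut. Invariance under substitutions is not
  required: it holds for the two least relations below because all axioms and rules are
  schematic.
\<close>

definition consequence_relation :: "conseq \<Rightarrow> bool" where
  "consequence_relation R \<longleftrightarrow>
     (\<forall>\<Gamma> \<phi>. \<phi> \<in> \<Gamma> \<longrightarrow> R \<Gamma> \<phi>) \<and>
     (\<forall>\<Gamma> \<Delta> \<phi>. (\<forall>\<psi>\<in>\<Delta>. R \<Gamma> \<psi>) \<longrightarrow> R \<Delta> \<phi> \<longrightarrow> R \<Gamma> \<phi>)"

definition finitary :: "conseq \<Rightarrow> bool" where
  "finitary R \<longleftrightarrow> (\<forall>\<Gamma> \<phi>. R \<Gamma> \<phi> \<longrightarrow> (\<exists>\<Delta>\<subseteq>\<Gamma>. finite \<Delta> \<and> R \<Delta> \<phi>))"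

definition rule_MP :: "conseq \<Rightarrow> bool" where
  "rule_MP R \<longleftrightarrow> (\<forall>\<phi> \<psi>. R {\<phi>, \<phi> \<^bold>\<rightarrow> \<psi>} \<psi>)"

definition rule_C :: "conseq \<Rightarrow> bool" where
  "rule_C R \<longleftrightarrow> (\<forall>\<phi> \<psi> \<gamma>. R {\<phi> \<^bold>\<rightarrow> \<psi>} ((\<gamma> \<box>\<rightarrow> \<phi>) \<^bold>\<rightarrow> (\<gamma> \<box>\<rightarrow> \<psi>)))"

definition rule_wC :: "conseq \<Rightarrow> bool" where
  "rule_wC R \<longleftrightarrow> (\<forall>\<phi> \<psi> \<gamma>. R {} (\<phi> \<^bold>\<rightarrow> \<psi>) \<longrightarrow> R {} ((\<gamma> \<box>\<rightarrow> \<phi>) \<^bold>\<rightarrow> (\<gamma> \<box>\<rightarrow> \<psi>)))"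

definition GV_closed :: "conseq \<Rightarrow> bool" where
  "GV_closed R \<longleftrightarrow>
     consequence_relation R \<and> finitary R \<and> (\<forall>\<phi>\<in>lewis_axioms. R {} \<phi>) \<and> rule_MP R \<and> rule_C R"

definition LV_closed :: "conseq \<Rightarrow> bool" where
  "LV_closed R \<longleftrightarrow>
     consequence_relation R \<and> finitary R \<and> (\<forall>\<phi>\<in>lewis_axioms. R {} \<phi>) \<and> rule_MP R \<and> rule_wC R"

definition GV :: conseq where
  "GV \<Gamma> \<phi> \<longleftrightarrow> (\<forall>R. GV_closed R \<longrightarrow> R \<Gamma> \<phi>)"

definition LV :: conseq where
  "LV \<Gamma> \<phi> \<longleftrightarrow> (\<forall>R. LV_closed R \<longrightarrow> R \<Gamma> \<phi>)"

text \<open>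
  An intersection of finitary relations need not be finitary, so it is checked here that
  \<open>GV\<close> and \<open>LV\<close> are themselves finitary and closed, i.e. that they are the least such
  relations.
\<close>

lemma consequence_relation_mono:
  assumes "consequence_relation R" "R \<Delta> \<phi>" "\<Delta> \<subseteq> \<Gamma>"
  shows "R \<Gamma> \<phi>"
proof -
  have "\<forall>\<psi>\<in>\<Delta>. R \<Gamma> \<psi>"
    using assms(1,3) unfolding consequence_relation_def by (simp add: subset_iff)
  with assms(1,2) show ?thesis
    unfolding consequence_relation_def by blast
qed

definition compact_part :: "conseq \<Rightarrow> conseq" where
  "compact_part R \<Gamma> \<phi> \<longleftrightarrow> (\<exists>\<Delta>\<subseteq>\<Gamma>. finite \<Delta> \<and> R \<Delta> \<phi>)"

lemma finitary_compact_part: "finitary (compact_part R)"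
  unfolding finitary_def compact_part_def by blast

lemma compact_part_finite:
  assumes "finite \<Gamma>" "R \<Gamma> \<phi>"
  shows "compact_part R \<Gamma> \<phi>"
  using assms unfolding compact_part_def by blast

lemma compact_part_empty: "compact_part R {} \<phi> \<longleftrightarrow> R {} \<phi>"
  unfolding compact_part_def by auto

lemma consequence_relation_compact_part:
  assumes R: "consequence_relation R"
  shows "consequence_relation (compact_part R)"
  unfolding consequence_relation_def
proof (intro conjI allI impI)
  fix \<Gamma> \<phi> assume "\<phi> \<in> (\<Gamma> :: form set)"
  moreover have "R {\<phi>} \<phi>"
    using R unfolding consequence_relation_def by blast
  ultimately show "compact_part R \<Gamma> \<phi>"
    unfolding compact_part_def by (intro exI[of _ "{\<phi>}"]) simp
next
  fix \<Gamma> \<Delta> \<phi>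
  assume *: "\<forall>\<psi>\<in>\<Delta>. compact_part R \<Gamma> \<psi>" and "compact_part R \<Delta> \<phi>"
  then obtain \<Delta>' where \<Delta>': "\<Delta>' \<subseteq> \<Delta>" "finite \<Delta>'" "R \<Delta>' \<phi>"
    unfolding compact_part_def by blast
  from * obtain F where F: "\<And>\<psi>. \<psi> \<in> \<Delta> \<Longrightarrow> F \<psi> \<subseteq> \<Gamma> \<and> finite (F \<psi>) \<and> R (F \<psi>) \<psi>"
    unfolding compact_part_def by metis
  define E where "E = \<Union>(F ` \<Delta>')"
  have "R E \<psi>" if "\<psi> \<in> \<Delta>'" for \<psi>
    by (rule consequence_relation_mono[OF R, of "F \<psi>"]) (use F that \<Delta>' in \<open>auto simp: E_def\<close>)
  with \<Delta>' R have "R E \<phi>"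
    unfolding consequence_relation_def by blast
  moreover have "E \<subseteq> \<Gamma>" "finite E"
    using F \<Delta>' by (auto simp: E_def)
  ultimately show "compact_part R \<Gamma> \<phi>"
    unfolding compact_part_def by blast
qed

lemma consequence_relation_Inf:
  assumes "\<And>R. P R \<Longrightarrow> consequence_relation R"
  shows "consequence_relation (\<lambda>\<Gamma> \<phi>. \<forall>R. P R \<longrightarrow> R \<Gamma> \<phi>)"
  unfolding consequence_relation_def
proof (intro conjI allI impI)
  fix \<Gamma> :: "form set" and \<phi> R assume "\<phi> \<in> \<Gamma>" "P R"
  with assms[OF \<open>P R\<close>] show "R \<Gamma> \<phi>"
    unfolding consequence_relation_def by blast
next
  fix \<Gamma> \<Delta> \<phi> R
  assume "\<forall>\<psi>\<in>\<Delta>. \<forall>R. P R \<longrightarrow> R \<Gamma> \<psi>" "\<forall>R. P R \<longrightarrow> R \<Delta> \<phi>" "P R"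
  then have "\<forall>\<psi>\<in>\<Delta>. R \<Gamma> \<psi>" "R \<Delta> \<phi>"
    by blast+
  with assms[OF \<open>P R\<close>] show "R \<Gamma> \<phi>"
    unfolding consequence_relation_def by blast
qed

lemma consequence_relation_GV: "consequence_relation GV"
  using consequence_relation_Inf[of GV_closed] unfolding GV_def GV_closed_def by auto

lemma consequence_relation_LV: "consequence_relation LV"
  using consequence_relation_Inf[of LV_closed] unfolding LV_def LV_closed_def by auto

lemma GV_least:
  shows "GV_closed GV" and "GV_closed R \<Longrightarrow> GV \<Gamma> \<phi> \<Longrightarrow> R \<Gamma> \<phi>"
proof -
  have rest: "\<forall>\<phi>\<in>lewis_axioms. GV {} \<phi>" "rule_MP GV" "rule_C GV"
    by (auto simp: GV_def GV_closed_def rule_MP_def rule_C_def)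
  then have "GV_closed (compact_part GV)"
    unfolding GV_closed_def rule_MP_def rule_C_def
    by (auto simp: finitary_compact_part compact_part_empty compact_part_finite
        consequence_relation_compact_part[OF consequence_relation_GV])
  then have "compact_part GV \<Gamma> \<phi>" if "GV \<Gamma> \<phi>" for \<Gamma> \<phi>
    using that[unfolded GV_def] by blast
  then have "finitary GV"
    unfolding finitary_def compact_part_def by blast
  with rest show "GV_closed GV"
    by (simp add: GV_closed_def consequence_relation_GV)
  show "GV_closed R \<Longrightarrow> GV \<Gamma> \<phi> \<Longrightarrow> R \<Gamma> \<phi>"
    unfolding GV_def by blast
qed

lemma LV_least:
  shows "LV_closed LV" and "LV_closed R \<Longrightarrow> LV \<Gamma> \<phi> \<Longrightarrow> R \<Gamma> \<phi>"
proof -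
  have rest: "\<forall>\<phi>\<in>lewis_axioms. LV {} \<phi>" "rule_MP LV" "rule_wC LV"
    by (auto simp: LV_def LV_closed_def rule_MP_def rule_wC_def)
  then have "LV_closed (compact_part LV)"
    unfolding LV_closed_def rule_MP_def rule_wC_def
    by (auto simp: finitary_compact_part compact_part_empty compact_part_finite
        consequence_relation_compact_part[OF consequence_relation_LV])
  then have "compact_part LV \<Gamma> \<phi>" if "LV \<Gamma> \<phi>" for \<Gamma> \<phi>
    using that[unfolded LV_def] by blast
  then have "finitary LV"
    unfolding finitary_def compact_part_def by blast
  with rest show "LV_closed LV"
    by (simp add: LV_closed_def consequence_relation_LV)
  show "LV_closed R \<Longrightarrow> LV \<Gamma> \<phi> \<Longrightarrow> R \<Gamma> \<phi>"
    unfolding LV_def by blast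
qed

definition theorems_of :: "conseq \<Rightarrow> form set" where
  "theorems_of R = {\<phi>. R {} \<phi>}"

end

theory Submission
  imports Defs
begin

(* Every GV-closed relation is LV-closed, because (C) together with cut yields (wC).
   Conversely, preservation of LV-theoremhood is a GV-closed relation: for it, (C) is just
   (wC) for LV. Its theorems are those of LV, so minimality of GV gives the other inclusion. *)

lemma LV_closed_if_GV_closed:
  assumes "GV_closed R"
  shows "LV_closed R"
proof -
  have "R {} ((\<gamma> \<box>\<rightarrow> \<phi>) \<^bold>\<rightarrow> (\<gamma> \<box>\<rightarrow> \<psi>))" if "R {} (\<phi> \<^bold>\<rightarrow> \<psi>)" for \<phi> \<psi> \<gamma>
  proof -
    have "\<forall>\<chi>\<in>{\<phi> \<^bold>\<rightarrow> \<psi>}. R {} \<chi>"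
      using that by simp
    moreover have "R {\<phi> \<^bold>\<rightarrow> \<psi>} ((\<gamma> \<box>\<rightarrow> \<phi>) \<^bold>\<rightarrow> (\<gamma> \<box>\<rightarrow> \<psi>))"
      using assms by (simp add: GV_closed_def rule_C_def)
    ultimately show ?thesis
      using assms unfolding GV_closed_def consequence_relation_def by blast
  qed
  then show ?thesis
    using assms by (simp add: GV_closed_def LV_closed_def rule_wC_def)
qed

text \<open>Turns admissibility in \<open>R\<close> into derivability: an inference with a premise
  that is not a theorem of \<open>R\<close> holds vacuously.\<close>

definition theorem_preserving :: "conseq \<Rightarrow> conseq" where
  "theorem_preserving R \<Gamma> \<phi> \<longleftrightarrow> (\<Gamma> \<subseteq> theorems_of R \<longrightarrow> \<phi> \<in> theorems_of R)"

lemma theorems_of_theorem_preserving: "theorems_of (theorem_preserving R) = theorems_of R"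
  by (simp add: theorems_of_def theorem_preserving_def)

lemma consequence_relation_theorem_preserving: "consequence_relation (theorem_preserving R)"
  unfolding consequence_relation_def theorem_preserving_def by blast

text \<open>At most one premise is ever needed: none if all premises are theorems of
  \<open>R\<close>, and otherwise a single non-theorem, which makes the inference vacuous.\<close>

lemma finitary_theorem_preserving: "finitary (theorem_preserving R)"
  unfolding finitary_def
proof (intro allI impI)
  fix \<Gamma> \<phi>
  assume *: "theorem_preserving R \<Gamma> \<phi>"
  show "\<exists>\<Delta>\<subseteq>\<Gamma>. finite \<Delta> \<and> theorem_preserving R \<Delta> \<phi>"
  proof (cases "\<Gamma> \<subseteq> theorems_of R")
    case True
    with * have "theorem_preserving R {} \<phi>"
      by (simp add: theorem_preserving_def)
    then show ?thesis
      by blast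
  next
    case False
    then obtain \<gamma> where "\<gamma> \<in> \<Gamma>" "\<gamma> \<notin> theorems_of R"
      by blast
    then show ?thesis
      by (intro exI[of _ "{\<gamma>}"]) (simp add: theorem_preserving_def)
  qed
qed

lemma GV_closed_theorem_preserving:
  assumes "LV_closed R"
  shows "GV_closed (theorem_preserving R)"
proof -
  \<comment> \<open>By cut, (MP) for \<open>R\<close> closes its theorems under detachment, which is
    all that (MP) for the new relation asks.\<close>
  have "R {} \<psi>" if "R {} \<phi>" "R {} (\<phi> \<^bold>\<rightarrow> \<psi>)" for \<phi> \<psi>
  proof -
    have "\<forall>\<chi>\<in>{\<phi>, \<phi> \<^bold>\<rightarrow> \<psi>}. R {} \<chi>" "R {\<phi>, \<phi> \<^bold>\<rightarrow> \<psi>} \<psi>"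
      using that assms by (simp_all add: LV_closed_def rule_MP_def)
    then show ?thesis
      using assms unfolding LV_closed_def consequence_relation_def by blast
  qed
  then have "rule_MP (theorem_preserving R)"
    by (auto simp: rule_MP_def theorem_preserving_def theorems_of_def)
  moreover have "rule_C (theorem_preserving R)" "\<forall>\<phi>\<in>lewis_axioms. theorem_preserving R {} \<phi>"
    using assms
    by (simp_all add: LV_closed_def rule_wC_def rule_C_def theorem_preserving_def theorems_of_def)
  ultimately show ?thesis
    by (simp add: GV_closed_def consequence_relation_theorem_preserving
        finitary_theorem_preserving)
qed

theorem theorem3p3:
  shows "theorems_of GV = theorems_of LV"
proof
  \<comment> \<open>Minimality is used at the empty premise set, where preserving theoremhood
    amounts to being a theorem of \<open>LV\<close>.\<close>
  have "theorems_of GV \<subseteq> theorems_of (theorem_preserving LV)"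
    using GV_least(2)[OF GV_closed_theorem_preserving[OF LV_least(1)]]
    by (auto simp: theorems_of_def)
  then show "theorems_of GV \<subseteq> theorems_of LV"
    by (simp add: theorems_of_theorem_preserving)
  show "theorems_of LV \<subseteq> theorems_of GV"
    using LV_least(2)[OF LV_closed_if_GV_closed[OF GV_least(1)]]
    by (auto simp: theorems_of_def)
qed

end
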